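(* Let $N\ge 2$, let $\tau_n\ge1$ be an integer, and let $K\in\mathbb{R}^{N\times N}$ be a symmetric matrix with $K\mathds{1}_N=0$, whose eigenvalues are $\lambda_1=0$ (with eigenvector $\mathds{1}_N$) and $\lambda_2,\dots,\lambda_N\in\mathbb{R}$. Let $x(k)\in\mathbb{R}^N$, $k\in\mathbb{N}$, be the network error, satisfying $$x(k+1)=x(k)-K\,x(k-\tau_n)+\Omega\,\bar w(k),\qquad \mathds{1}_N^\top x(k)=0,$$ where $\Omega=I_N-\frac1N\mathds{1}_N\mathds{1}_N^\top$ and $\bar w(k)$, $k\in\mathbb{N}$, are independent standard Gaussian vectors in $\mathbb{R}^N$. Then the network error is mean-square stable if and only if $$\lambda_j\in\left(0,\ 2\sin\left(\frac{\pi}{2}\,\frac{1}{2\tau_n+1}\right)\right),\qquad j=2,\dots,N.$$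
   Context: $\mathds{1}_N\in\mathbb{R}^N$ is the vector of all ones. The setting: $N$ agents with scalar states $\bar x_i(k)$ obey $\bar x_i(k+1)=\bar x_i(k)+u_{P,i}(k)+\bar w_i(k)$ with independent noises $\bar w_i(k)\sim\mathcal{N}(0,1)$ and delayed proportional feedback $u_P(k)=-K\bar x(k-\tau_n)$, where $\tau_n$ is the number of delay steps; the network error is $x(k)=\Omega\bar x(k)$, the mismatch between agent states and the average network state. Initial histories $x(-\tau_n),\dots,x(0)$ are deterministic and orthogonal to $\mathds{1}_N$. Mean-square stable means that, for every such initial history, $\lim_{k\to\infty}\mathbb{E}[\|x(k)\|^2]$ exists and is finite. *)

theory Defs
  imports "HOL-Probability.Probability"
begin

(* The vector 1 :: real^'n is the all-ones vector, and CARD('n) is the number N of agents. *)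

(* The list lam 1, ..., lam N of eigenvalues of A, repeated according to multiplicity,
   i.e. the roots of the characteristic polynomial det (t I - A). *)
definition eigenvalue_list :: "real^'n^'n \<Rightarrow> (nat \<Rightarrow> real) \<Rightarrow> bool" where
  "eigenvalue_list A lam \<longleftrightarrow>
     (\<forall>t. det (mat t - A) = (\<Prod>j = 1..CARD('n). t - lam j))"

definition Omega :: "real^'n^'n" where
  "Omega = mat 1 - (1 / real CARD('n)) *\<^sub>R (\<chi> i j. 1)"

definition standard_gaussian_vector :: "'a measure \<Rightarrow> ('a \<Rightarrow> real^'n) \<Rightarrow> bool" where
  "standard_gaussian_vector M X \<longleftrightarrow>
     prob_space.indep_vars M (\<lambda>_. borel) (\<lambda>i \<omega>. X \<omega> $ i) UNIV \<and>
     (\<forall>i. distributed M lborel (\<lambda>\<omega>. X \<omega> $ i) std_normal_density)"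

(* The trajectory with initial history h on the times -tau, ..., 0; the values of h
   before -tau are never used. *)
function net_error ::
  "real^'n^'n \<Rightarrow> nat \<Rightarrow> (nat \<Rightarrow> 'a \<Rightarrow> real^'n) \<Rightarrow> (int \<Rightarrow> real^'n) \<Rightarrow> int \<Rightarrow> 'a \<Rightarrow> real^'n"
where
  "net_error K tau w h s \<omega> =
     (if s \<le> 0 then h s
      else net_error K tau w h (s - 1) \<omega>
           - K *v net_error K tau w h (s - 1 - int tau) \<omega>
           + Omega *v w (nat (s - 1)) \<omega>)"
  by pat_completeness auto
termination
  by (relation "Wellfounded.measure (\<lambda>(K, tau, w, h, s, \<omega>). nat s)") auto

declare net_error.simps [simp del]

lemma net_error_initial: "s \<le> 0 \<Longrightarrow> net_error K tau w h s \<omega> = h s"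
  by (simp add: net_error.simps)

lemma net_error_step:
  "net_error K tau w h (int k + 1) \<omega> =
     net_error K tau w h (int k) \<omega>
     - K *v net_error K tau w h (int k - int tau) \<omega>
     + Omega *v w k \<omega>"
  by (subst net_error.simps) simp

(* Histories are deterministic and orthogonal to the all-ones vector. Integrability is
   required explicitly because the Bochner integral of a non-integrable function is 0. *)
definition mean_square_stable ::
  "'a measure \<Rightarrow> real^'n^'n \<Rightarrow> nat \<Rightarrow> (nat \<Rightarrow> 'a \<Rightarrow> real^'n) \<Rightarrow> bool"
where
  "mean_square_stable M K tau w \<longleftrightarrow>
     (\<forall>h. (\<forall>s \<in> {- int tau..0}. 1 \<bullet> h s = 0) \<longrightarrow>
        (\<forall>k::nat. integrable M (\<lambda>\<omega>. (norm (net_error K tau w h (int k) \<omega>))\<^sup>2)) \<and>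
        convergent (\<lambda>k::nat.
          prob_space.expectation M (\<lambda>\<omega>. (norm (net_error K tau w h (int k) \<omega>))\<^sup>2)))"

lemma inner_one_Omega: "1 \<bullet> (Omega *v (v :: real^'n)) = 0"
proof -
  have "transpose (Omega :: real^'n^'n) = Omega"
    by (auto simp: Omega_def transpose_def mat_def vec_eq_iff)
  moreover have "(Omega :: real^'n^'n) *v 1 = 0"
  proof -
    have "((\<chi> i j. 1) :: real^'n^'n) *v (1 :: real^'n) = real CARD('n) *\<^sub>R (1 :: real^'n)"
      by (simp add: matrix_vector_mult_def vec_eq_iff)
    then show ?thesis
      by (simp add: Omega_def matrix_vector_mult_diff_rdistrib
          flip: scaleR_matrix_vector_assoc)
  qed
  ultimately show ?thesis
    by (metis dot_lmul_matrix inner_zero_left transpose_matrix_vector)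
qed

(* The constraint that the network error is orthogonal to the all-ones vector is inherited
   from the initial history. *)
lemma inner_one_net_error:
  fixes K :: "real^'n^'n"
  assumes "transpose K = K" and "K *v 1 = 0"
    and "\<forall>s \<in> {- int tau..0}. 1 \<bullet> h s = 0" and "- int tau \<le> s"
  shows "1 \<bullet> net_error K tau w h s \<omega> = 0"
proof -
  have K: "1 \<bullet> (K *v v) = 0" for v
    by (metis assms(1,2) dot_lmul_matrix inner_zero_left transpose_matrix_vector)
  show ?thesis
    using assms(4)
  proof (induction "nat s" arbitrary: s rule: less_induct)
    case less
    show ?case
    proof (cases "s \<le> 0")
      case True
      then show ?thesis using assms(3) less.prems by (simp add: net_error_initial)
    next
      case False
      then show ?thesis
        using less.hyps[of "s - 1"] less.prems
        by (simp add: net_error.simps[of K tau w h s] inner_add_right inner_diff_right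
            K inner_one_Omega)
    qed
  qed
qed

end

theory Submission
  imports Defs "HOL-Complex_Analysis.Cauchy_Integral_Formula"
begin

text \<open>In an orthonormal eigenbasis of \<open>K\<close> on the complement of the all-ones vector the
  network error splits into scalar delayed recursions driven by unit white noise, so
  \<open>E \<parallel>x k\<parallel>\<^sup>2\<close> is the sum over the modes of the squared free response and the
  partial sums of the squared impulse response. Hence stability means that the impulse response
  of every mode is square summable. Its generating function is \<open>1 / (1 - z + \<lambda> z\<^sup>m\<^sup>+\<^sup>1)\<close>, and the
  roots of the reciprocal polynomial \<open>z\<^sup>m\<^sup>+\<^sup>1 - z\<^sup>m + \<lambda>\<close> lie in the open unit disc precisely for
  gains \<open>\<lambda>\<close> between \<open>0\<close> and the stated bound.\<close>

subsection \<open>The scalar delayed recursion\<close>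

text \<open>Times are shifted by the delay \<open>m\<close>, so that index \<open>0\<close> is the start of the history and
  index \<open>m\<close> is time \<open>0\<close>.\<close>

function impulse :: "real \<Rightarrow> nat \<Rightarrow> nat \<Rightarrow> real" where
  "impulse l m n =
     (if n < m then 0 else if n = m then 1
      else impulse l m (n - 1) - l * impulse l m (n - 1 - m))"
  by pat_completeness auto
termination
  by (relation "Wellfounded.measure (\<lambda>(l, m, n). n)") auto

declare impulse.simps [simp del]

lemma impulse_less [simp]: "n < m \<Longrightarrow> impulse l m n = 0"
  and impulse_self [simp]: "impulse l m m = 1"
  by (simp_all add: impulse.simps)

lemma impulse_step:
  "impulse l m (k + m + 1) = impulse l m (k + m) - l * impulse l m k"
  by (subst impulse.simps) simp

text \<open>Variation of constants: \<open>a m\<close> acts as an impulse at index \<open>m\<close>,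
  and each earlier \<open>a i\<close> enters only through the feedback, as an impulse of size
  \<open>- l\<close> times \<open>a i\<close> at index \<open>i + m + 1\<close>.\<close>

lemma recurrence_via_impulse:
  fixes a :: "nat \<Rightarrow> 'v::real_vector"
  assumes "\<And>k. a (k + m + 1) = a (k + m) - l *\<^sub>R a k"
  shows "a (k + m) = impulse l m (k + m) *\<^sub>R a m
           - l *\<^sub>R (\<Sum>i<m. impulse l m (k + m - 1 - i) *\<^sub>R a i)"
  using assms
proof (induction k arbitrary: a)
  case 0
  show ?case by simp
next
  case (Suc k)
  \<comment> \<open>The induction hypothesis is applied to the sequence shifted by one. Its history
    loses \<open>a 0\<close> and gains \<open>a m\<close>, so its sum differs from the old one by
    \<open>c m - c 0\<close>.\<close>
  define c where "c i = impulse l m (k + m - i) *\<^sub>R a i" for i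
  have "(\<Sum>i<m. impulse l m (k + m - 1 - i) *\<^sub>R a (Suc i)) = (\<Sum>i<m. c (Suc i))"
    by (simp add: c_def)
  also have "\<dots> = (\<Sum>i<m. c i) + c m - c 0"
    by (simp flip: sum.lessThan_Suc add: sum.lessThan_Suc_shift del: sum.lessThan_Suc)
  finally have shift: "(\<Sum>i<m. impulse l m (k + m - 1 - i) *\<^sub>R a (Suc i)) = (\<Sum>i<m. c i) + c m - c 0" .
  have "a (Suc k + m) = impulse l m (k + m) *\<^sub>R a (Suc m)
           - l *\<^sub>R (\<Sum>i<m. impulse l m (k + m - 1 - i) *\<^sub>R a (Suc i))"
    using Suc.IH[of "\<lambda>n. a (Suc n)"] Suc.prems[of "Suc _"] by simp
  also have "a (Suc m) = a m - l *\<^sub>R a 0"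
    using Suc.prems[of 0] by simp
  finally show ?case
    unfolding shift using impulse_step[of l m k]
    by (simp add: c_def scaleR_diff_left scaleR_diff_right scaleR_add_right)
qed

text \<open>The representation has a fixed number of terms, each decaying with
  \<open>impulse\<close>. Normed spaces cover both uses: real modes and complex powers of a
  characteristic root.\<close>

lemma recurrence_tendsto_0:
  fixes a :: "nat \<Rightarrow> 'v::real_normed_vector"
  assumes "\<And>k. a (k + m + 1) = a (k + m) - l *\<^sub>R a k"
    and "impulse l m \<longlonglongrightarrow> 0"
  shows "a \<longlonglongrightarrow> 0"
proof -
  have *: "(\<lambda>k. impulse l m (k + m - 1 - i)) \<longlonglongrightarrow> 0" if "i < m" for i
  proof -
    have "(\<lambda>k. impulse l m (k + (m - 1 - i))) \<longlonglongrightarrow> 0"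
      by (rule LIMSEQ_ignore_initial_segment[OF assms(2)])
    also have "(\<lambda>k. impulse l m (k + (m - 1 - i))) = (\<lambda>k. impulse l m (k + m - 1 - i))"
      using that by (simp add: add_diff_eq)
    finally show ?thesis .
  qed
  have "(\<lambda>k. impulse l m (k + m) *\<^sub>R a m
           - l *\<^sub>R (\<Sum>i<m. impulse l m (k + m - 1 - i) *\<^sub>R a i))
        \<longlonglongrightarrow> 0 *\<^sub>R a m - l *\<^sub>R (\<Sum>i<m. 0 *\<^sub>R a i)"
    using * LIMSEQ_ignore_initial_segment[OF assms(2), of m]
    by (intro tendsto_diff tendsto_scaleR tendsto_const tendsto_sum) auto
  then have "(\<lambda>k. a (k + m)) \<longlonglongrightarrow> 0"
    unfolding recurrence_via_impulse[of a m l, OF assms(1), symmetric] by simp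
  then show ?thesis
    by (rule LIMSEQ_offset[of a m])
qed

section \<open>Generating function of the impulse response\<close>

text \<open>The characteristic polynomial \<open>z^(m+1) - z^m + l\<close> with its coefficients
  reversed, taken as a formal power series so that it can be inverted.\<close>

definition char_fps :: "real \<Rightarrow> nat \<Rightarrow> complex fps" where
  "char_fps l m = 1 - fps_X + fps_const (of_real l) * fps_X ^ Suc m"

text \<open>Powers of \<open>fps_X\<close> shift coefficients, so the recursion says that the
  product of the two series has no coefficient beyond the constant one.\<close>

lemma impulse_generating_function:
  "Abs_fps (\<lambda>n. of_real (impulse l m (n + m))) = inverse (char_fps l m)"
proof -
  define G :: "complex fps" where "G = Abs_fps (\<lambda>n. of_real (impulse l m (n + m)))"
  have "fps_nth (char_fps l m * G) n = fps_nth 1 n" for n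
  proof -
    have "fps_nth (char_fps l m * G) n =
        fps_nth G n - fps_nth (fps_X * G) n + of_real l * fps_nth (fps_X ^ Suc m * G) n"
      by (simp only: char_fps_def ring_distribs mult_1_left fps_sub_nth fps_add_nth
          mult.assoc fps_mult_left_const_nth)
    \<comment> \<open>For \<open>0 < n \<le> m\<close> the product has no delayed term, in agreement
      with the recursion, where \<open>impulse l m (n - 1)\<close> is zero.\<close>
    also have "\<dots> = fps_nth 1 n"
      using impulse_step[of l m "n - 1"]
      by (cases n) (auto simp: G_def fps_X_power_mult_nth simp del: power_Suc)
    finally show ?thesis .
  qed
  then have "char_fps l m * G = 1"
    by (simp add: fps_eq_iff)
  then show ?thesis
    unfolding G_def[symmetric] by (metis fps_inverse_unique mult.commute)
qed

lemma eval_char_fps: "eval_fps (char_fps l m) z = 1 - z + of_real l * z ^ Suc m"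
  and conv_radius_char_fps: "fps_conv_radius (char_fps l m) = \<infinity>"
proof -
  define p :: "complex poly" where "p = 1 - [:0, 1:] + smult (of_real l) ([:0, 1:] ^ Suc m)"
  have "char_fps l m = fps_of_poly p"
    by (simp only: char_fps_def p_def fps_of_poly_simps fps_const_0_eq_0 fps_const_1_eq_1
        mult_zero_left mult_1_left add_0_left add_0_right)
  then show "eval_fps (char_fps l m) z = 1 - z + of_real l * z ^ Suc m"
    "fps_conv_radius (char_fps l m) = \<infinity>"
    by (simp_all add: p_def)
qed

text \<open>The zero set is closed and misses the compact unit disc, so it lies at some distance
  \<open>d > 0\<close> from it. A zero of modulus below \<open>1 + d\<close> would be too close to
  its radial projection.\<close>

lemma zero_free_disc_enlarge:
  fixes f :: "complex \<Rightarrow> complex"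
  assumes cont: "continuous_on UNIV f" and nz: "\<And>z. norm z \<le> 1 \<Longrightarrow> f z \<noteq> 0"
  obtains r :: real where "r > 1" "\<And>z. norm z < r \<Longrightarrow> f z \<noteq> 0"
proof -
  have "closed {z. f z = 0}"
    by (intro closed_Collect_eq cont continuous_intros)
  moreover have "compact (cball 0 1 :: complex set)"
    by simp
  moreover have "cball 0 1 \<inter> {z. f z = 0} = {}"
    using nz by auto
  ultimately obtain d where "d > 0" and d: "\<forall>x\<in>cball 0 1. \<forall>y\<in>{z. f z = 0}. d \<le> dist x y"
    using separate_compact_closed[of "cball 0 1" "{z. f z = 0}"] by blast
  show thesis
  proof
    show "1 + d > 1" using \<open>d > 0\<close> by simp
    fix z :: complex assume z: "norm z < 1 + d"
    show "f z \<noteq> 0"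
    proof
      assume 0: "f z = 0"
      then have "norm z > 1" using nz not_le by blast
      then have "dist (z / norm z) z = norm z - 1"
      proof -
        have "z / norm z - z = of_real (1 / norm z - 1) * z"
          by (simp add: algebra_simps)
        then have "dist (z / norm z) z = \<bar>1 / norm z - 1\<bar> * norm z"
          unfolding dist_norm by (metis norm_mult norm_of_real)
        then show ?thesis using \<open>norm z > 1\<close> by (auto simp: field_simps abs_if)
      qed
      moreover have "z / norm z \<in> cball 0 1"
        using \<open>norm z > 1\<close> by (simp add: norm_divide)
      ultimately show False using d 0 z by fastforce
    qed
  qed
qed

text \<open>The inverse series converges as far as its denominator has no zero. A radius beyond 1
  gives absolute convergence at the point 1.\<close>

lemma summable_impulse:
  assumes "\<And>z :: complex. norm z \<le> 1 \<Longrightarrow> 1 - z + of_real l * z ^ Suc m \<noteq> 0"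
  shows "summable (\<lambda>n. \<bar>impulse l m n\<bar>)"
proof -
  obtain r :: real where "r > 1"
    and r: "\<And>z :: complex. norm z < r \<Longrightarrow> 1 - z + of_real l * z ^ Suc m \<noteq> 0"
    by (rule zero_free_disc_enlarge[of "\<lambda>z. 1 - z + of_real l * z ^ Suc m"])
      (use assms in \<open>auto intro!: continuous_intros\<close>)
  let ?G = "inverse (char_fps l m)"
  have "fps_conv_radius ?G \<ge> min (ereal r) (fps_conv_radius (char_fps l m))"
    by (rule fps_conv_radius_inverse) (simp add: eval_char_fps r del: power_Suc)
  moreover have "ereal (norm (1 :: complex)) < ereal r"
    using \<open>r > 1\<close> by simp
  ultimately have "conv_radius (fps_nth ?G) > norm (1 :: complex)"
    unfolding conv_radius_char_fps by (auto simp: fps_conv_radius_def intro: less_le_trans[of _ "ereal r"])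
  then have "summable (\<lambda>n. norm (fps_nth ?G n * 1 ^ n))"
    by (rule abs_summable_in_conv_radius)
  then have "summable (\<lambda>n. \<bar>impulse l m (n + m)\<bar>)"
    by (simp flip: impulse_generating_function)
  then show ?thesis using summable_iff_shift by blast
qed

section \<open>Characteristic roots and the unit circle\<close>

text \<open>The difference of the sines factors as
  \<open>2 * sin (t / 2) * cos ((2 * m + 1) * t / 2)\<close>, and the cosine is positive up to the
  angle \<open>pi / (2 * m + 1)\<close>.\<close>

lemma sin_less_sin_next:
  assumes "0 < t" "t < pi / (2 * real m + 1)"
  shows "sin (real m * t) < sin ((real m + 1) * t)"
proof -
  have diff: "sin ((real m + 1) * t) - sin (real m * t) = 2 * sin (t / 2) * cos ((2 * real m + 1) * t / 2)"
    by (simp add: sin_diff_sin algebra_simps add_divide_distrib flip: diff_divide_distrib)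
  have "t * (2 * real m + 1) < pi"
    using assms by (simp add: field_simps)
  moreover have "t * 1 \<le> t * (2 * real m + 1)"
    using assms by (intro mult_left_mono) auto
  ultimately have "t < pi" "(2 * real m + 1) * t < pi"
    by (simp_all add: mult.commute)
  then have "0 < sin (t / 2)" "0 < cos ((2 * real m + 1) * t / 2)"
    using assms by (auto intro!: sin_gt_zero cos_gt_zero)
  moreover note diff
  ultimately show ?thesis
    by (smt (verit) mult_pos_pos)
qed

text \<open>Same factorisation: past \<open>pi / (2 * m + 1)\<close> the cosine is no longer
  positive. Its sign is read off after reflecting the angle at \<open>pi\<close>.\<close>

lemma sin_next_le_sin:
  assumes "pi / (2 * real m + 1) \<le> t" "t \<le> pi / (real m + 1)"
  shows "sin ((real m + 1) * t) \<le> sin (real m * t)"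
proof -
  have diff: "sin ((real m + 1) * t) - sin (real m * t) = 2 * sin (t / 2) * cos ((2 * real m + 1) * t / 2)"
    by (simp add: sin_diff_sin algebra_simps add_divide_distrib flip: diff_divide_distrib)
  have *: "pi \<le> (2 * real m + 1) * t" "(real m + 1) * t \<le> pi"
    using assms by (simp_all add: field_simps)
  have "0 \<le> t"
    using assms(1) by (rule order_trans[rotated]) simp
  have "0 \<le> real m * t" using \<open>0 \<le> t\<close> by simp
  then have "t \<le> pi" using * by (simp add: algebra_simps)
  then have "0 \<le> sin (t / 2)"
    using \<open>0 \<le> t\<close>
    by (intro sin_ge_zero) auto
  moreover have "0 \<le> cos (pi - (2 * real m + 1) * t / 2)"
    by (rule cos_ge_zero) (use * \<open>0 \<le> t\<close> in \<open>auto simp: algebra_simps\<close>)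
  ultimately show ?thesis
    using diff mult_nonneg_nonneg[of "2 * sin (t / 2)" "cos (pi - (2 * real m + 1) * t / 2)"] by simp
qed

text \<open>The chord from 1 to \<open>cis (pi / (2 * m + 1))\<close>. At this gain that point of
  the unit circle is a characteristic root.\<close>

abbreviation (input) gain_bound :: "nat \<Rightarrow> real" where
  "gain_bound m \<equiv> 2 * sin (pi / 2 * (1 / (2 * real m + 1)))"

text \<open>With \<open>t = Arg z\<close>, the squared distance from 1 is
  \<open>(norm z - 1)^2 + 4 * norm z * sin (t / 2)^2\<close>. Outside the open unit disc this is at
  least the squared chord of the angle \<open>t\<close>.\<close>

lemma angle_less:
  fixes z :: complex
  assumes "norm z \<ge> 1" "norm (1 - z) < 2 * sin (b / 2)" "0 \<le> b" "b \<le> pi"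
  shows "\<bar>Arg z\<bar> < b"
proof (rule ccontr)
  define t where "t = Arg z"
  assume "\<not> \<bar>Arg z\<bar> < b"
  then have t: "b \<le> \<bar>t\<bar>" "\<bar>t\<bar> \<le> pi"
    using Arg_bounded[of z] by (auto simp: t_def)
  have z: "z = norm z * cis t"
    using rcis_cmod_Arg[of z] by (simp add: t_def rcis_def)
  have "sin (b / 2) \<le> sin (\<bar>t\<bar> / 2)"
    using t assms by (intro sin_monotone_2pi_le) auto
  moreover have "(norm (1 - z))\<^sup>2 = (norm z - 1)\<^sup>2 + 2 * norm z * (1 - cos t)"
  proof -
    have "(norm (1 - z))\<^sup>2 = (1 - norm z * cos t)\<^sup>2 + (norm z * sin t)\<^sup>2"
      by (subst (1) z) (simp add: cmod_power2)
    also have "\<dots> = 1 - 2 * norm z * cos t + (norm z)\<^sup>2 * ((sin t)\<^sup>2 + (cos t)\<^sup>2)"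
      by (simp add: power2_eq_square algebra_simps del: sin_cos_squared_add3)
    finally show ?thesis by (simp add: power2_eq_square algebra_simps)
  qed
  moreover have "1 - cos t = 2 * (sin (\<bar>t\<bar> / 2))\<^sup>2"
    using cos_double_sin[of "\<bar>t\<bar> / 2"] by simp
  moreover have "(2 * sin (\<bar>t\<bar> / 2))\<^sup>2 \<le> norm z * (2 * sin (\<bar>t\<bar> / 2))\<^sup>2"
    using mult_right_mono[OF assms(1), of "(2 * sin (\<bar>t\<bar> / 2))\<^sup>2"] by simp
  ultimately have "(2 * sin (\<bar>t\<bar> / 2))\<^sup>2 \<le> (norm (1 - z))\<^sup>2"
    by (simp add: power_mult_distrib) (smt (verit) zero_le_power2)
  then have "2 * sin (\<bar>t\<bar> / 2) \<le> norm (1 - z)"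
    by (rule power2_le_imp_le) simp
  with \<open>sin (b / 2) \<le> _\<close> assms show False by simp
qed

text \<open>Taking norms in \<open>z^m * (1 - z) = l\<close> gives
  \<open>norm (1 - z) \<le> l\<close>, so a root outside the open disc has argument below
  \<open>pi / (2 * m + 1)\<close>. There the imaginary part is nonzero unless the root is real, and
  a real root fails by sign.\<close>

lemma char_root_inside:
  fixes z :: complex
  assumes l: "0 < l" "l < gain_bound m" and z: "norm z \<ge> 1"
  shows "z ^ Suc m - z ^ m + of_real l \<noteq> 0"
proof
  assume root: "z ^ Suc m - z ^ m + of_real l = 0"
  define r t where "r = norm z" and "t = Arg z"
  have zr: "z = rcis r t"
    by (simp add: r_def t_def rcis_cmod_Arg)
  have "z ^ m * (1 - z) = of_real l"
    using root by (simp add: algebra_simps)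
  then have "norm z ^ m * norm (1 - z) = l"
    using l by (metis norm_mult norm_of_real norm_power abs_of_pos)
  moreover have "1 * norm (1 - z) \<le> norm z ^ m * norm (1 - z)"
    using one_le_power[OF z, of m] by (intro mult_right_mono) auto
  ultimately have "norm (1 - z) < 2 * sin (pi / (2 * real m + 1) / 2)"
    using l by (simp add: field_simps)
  then have t: "\<bar>t\<bar> < pi / (2 * real m + 1)"
    unfolding t_def using z by (intro angle_less) (auto simp: field_simps)
  have "r \<ge> 1" using z by (simp add: r_def)
  then have "r ^ m > 0" by (intro zero_less_power) simp
  have "Im (z ^ Suc m - z ^ m + of_real l) = r ^ m * (r * sin ((real m + 1) * t) - sin (real m * t))"
    unfolding zr DeMoivre2 by (simp add: rcis_def algebra_simps)
  then have "r ^ m * (r * sin ((real m + 1) * t) - sin (real m * t)) = 0"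
    by (simp only: root zero_complex.sel)
  then have im: "r * sin ((real m + 1) * t) = sin (real m * t)"
    using \<open>r \<ge> 1\<close> by auto
  show False
  proof (cases "t = 0")
    case True
    then have zr: "z = of_real r" using zr by (simp add: rcis_def)
    have "of_real (r ^ Suc m - r ^ m + l) = (0 :: complex)"
      using root unfolding zr by simp
    then have "r ^ Suc m - r ^ m + l = 0" by (simp only: of_real_eq_0_iff)
    moreover have "r ^ m \<le> r ^ Suc m" using z by (intro power_increasing) (auto simp: r_def)
    ultimately show False using l by simp
  next
    case False
    define s where "s = \<bar>t\<bar>"
    have s: "0 < s" "s < pi / (2 * real m + 1)" using False t by (auto simp: s_def)
    \<comment> \<open>Sine is odd, so conjugate roots give the same equation and the angle may be
      taken positive.\<close>
    have im: "r * sin ((real m + 1) * s) = sin (real m * s)"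
      using im by (auto simp: s_def abs_if)
    have "sin (real m * s) < sin ((real m + 1) * s)"
      using s by (rule sin_less_sin_next)
    moreover have "0 \<le> sin (real m * s)"
    proof (rule sin_ge_zero)
      have "real m * s \<le> (2 * real m + 1) * s" using s by (intro mult_right_mono) auto
      also have "\<dots> \<le> pi" using s by (simp add: field_simps)
      finally show "real m * s \<le> pi" .
    qed (use s in simp)
    moreover have "1 * sin ((real m + 1) * s) \<le> r * sin ((real m + 1) * s)"
      using z calculation by (intro mult_right_mono) (auto simp: r_def)
    ultimately show False using im by simp
  qed
qed

text \<open>The witness is \<open>r cis t\<close>: the imaginary part of the equation forces
  \<open>r = sin (m t) / sin ((m + 1) t)\<close>, and the real part then reads
  \<open>r\<^sup>m sin t / sin ((m + 1) t) = l\<close>. Clearing denominators gives a function of \<open>t\<close>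
  with a sign change between \<open>pi / (2 m + 1)\<close>, where \<open>r = 1\<close> and
  \<open>l\<close> is the critical gain, and \<open>pi / (m + 1)\<close>.\<close>

lemma char_root_outside:
  assumes m: "m \<ge> 1" and l: "gain_bound m \<le> l"
  obtains z :: complex where "norm z \<ge> 1" "z ^ Suc m - z ^ m + of_real l = 0"
proof -
  define a b where "a = pi / (2 * real m + 1)" and "b = pi / (real m + 1)"
  define f where "f t = sin (real m * t) ^ m * sin t - l * sin ((real m + 1) * t) ^ Suc m" for t
  have ab: "0 < a" "a < b" "b < pi" using m by (auto simp: a_def b_def field_simps)
  have m_ab: "real m * t < pi" "0 < real m * t" if "0 < t" "t \<le> b" for t
  proof -
    have "real m * t \<le> real m * b" using that by (intro mult_left_mono) auto
    also have "\<dots> < pi" by (simp add: b_def field_simps)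
    finally show "real m * t < pi" .
    show "0 < real m * t" using that m by simp
  qed
  \<comment> \<open>At \<open>a\<close> the two angles are supplementary, hence
    \<open>r = 1\<close>. Both sines equal \<open>cos (a / 2)\<close>, which leaves
    \<open>2 * sin (a / 2) - l\<close> as the factor deciding the sign of
    \<open>f a\<close>.\<close>
  have "sin ((real m + 1) * a) = sin (real m * a)"
  proof -
    have "(real m + 1) * a = pi - real m * a" by (simp add: a_def field_simps)
    then show ?thesis by (metis sin_pi_minus)
  qed
  moreover have "sin ((real m + 1) * a) = cos (a / 2)"
  proof -
    have "(real m + 1) * a = a / 2 + pi / 2" by (simp add: a_def field_simps)
    then show ?thesis by (simp add: sin_add)
  qed
  moreover have "sin a = 2 * sin (a / 2) * cos (a / 2)"
    using sin_double[of "a / 2"] by simp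
  ultimately have "f a = cos (a / 2) ^ Suc m * (2 * sin (a / 2) - l)"
    by (simp add: f_def algebra_simps)
  moreover have "2 * sin (a / 2) \<le> l"
    using l by (simp add: a_def)
  moreover have "cos (a / 2) \<ge> 0"
    using ab by (intro cos_ge_zero) auto
  ultimately have "f a \<le> 0"
    by (simp add: mult_nonneg_nonpos)
  moreover have "f b \<ge> 0"
  proof -
    have "sin ((real m + 1) * b) = 0" by (simp add: b_def)
    moreover have "0 \<le> sin (real m * b)" "0 \<le> sin b"
      using m_ab[of b] ab by (auto intro!: sin_ge_zero)
    ultimately show ?thesis by (simp add: f_def)
  qed
  moreover have "continuous_on {a..b} f"
    unfolding f_def by (intro continuous_intros)
  ultimately obtain t where t: "a \<le> t" "t \<le> b" "f t = 0"
    using IVT'[of f a 0 b] ab by auto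
  define S where "S = sin ((real m + 1) * t)"
  have pos: "0 < sin (real m * t)" "0 < sin t"
    using m_ab[of t] t ab by (auto intro!: sin_gt_zero)
  \<comment> \<open>If \<open>S\<close> vanished, as it does at \<open>b\<close>, then
    \<open>f t\<close> would be the positive product of the other sines.\<close>
  have "S \<noteq> 0"
    using t(3) pos by (auto simp: f_def S_def)
  moreover have "0 \<le> S"
    unfolding S_def
  proof (rule sin_ge_zero)
    show "(real m + 1) * t \<le> pi" using t by (simp add: b_def field_simps)
  qed (use t ab in auto)
  ultimately have "S > 0" by simp
  have S_le: "S \<le> sin (real m * t)"
    unfolding S_def using t by (intro sin_next_le_sin) (auto simp: a_def b_def)
  define r where "r = sin (real m * t) / S"
  have r: "r * S = sin (real m * t)" using \<open>S > 0\<close> by (simp add: r_def)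
  have "r \<ge> 1" using S_le \<open>S > 0\<close> by (simp add: r_def)
  define z where "z = rcis r t"
  have "Im (z ^ Suc m - z ^ m + of_real l) = r ^ m * (r * S - sin (real m * t))"
    unfolding z_def DeMoivre2 by (simp add: rcis_def algebra_simps S_def)
  then have im: "Im (z ^ Suc m - z ^ m + of_real l) = 0" using r by simp
  \<comment> \<open>Multiplying by \<open>S\<close> lets \<open>r * S\<close> be replaced by
    \<open>sin (m * t)\<close>. The subtraction formula then collapses the bracket to
    \<open>- sin t\<close>.\<close>
  have "S * Re (z ^ Suc m - z ^ m + of_real l)
      = r ^ m * (r * S * cos ((real m + 1) * t) - S * cos (real m * t)) + l * S"
    unfolding z_def DeMoivre2 by (simp add: rcis_def algebra_simps)
  also have "r * S * cos ((real m + 1) * t) - S * cos (real m * t) = - sin t"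
    unfolding r unfolding S_def using sin_diff[of "(real m + 1) * t" "real m * t"] by (simp add: algebra_simps)
  also have "r ^ m * - sin t + l * S = - f t / S ^ m"
  proof -
    have "f t = (r * S) ^ m * sin t - l * S ^ Suc m"
      unfolding r by (simp only: f_def S_def)
    also have "\<dots> = S ^ m * (r ^ m * sin t - l * S)"
      by (simp only: power_mult_distrib power_Suc right_diff_distrib ac_simps)
    finally show ?thesis using \<open>S > 0\<close> by simp
  qed
  finally have "Re (z ^ Suc m - z ^ m + of_real l) = 0"
    using t \<open>S > 0\<close> by simp
  with im have "z ^ Suc m - z ^ m + of_real l = 0"
    by (simp add: complex_eq_iff)
  moreover have "norm z \<ge> 1" using \<open>r \<ge> 1\<close> by (simp add: z_def)
  ultimately show thesis using that by blast
qed

section \<open>Gains with a decaying impulse response\<close>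

text \<open>For \<open>l \<le> 0\<close> the feedback only adds nonnegative terms, so the response
  never drops below 1 again. For large \<open>l\<close> the powers of a root of modulus at least 1
  solve the recursion without decaying.\<close>

lemma gain_range_if_impulse_tendsto_0:
  assumes m: "m \<ge> 1" and lim: "impulse l m \<longlonglongrightarrow> 0"
  shows "0 < l" "l < gain_bound m"
proof -
  show "0 < l"
  proof (rule ccontr)
    assume "\<not> 0 < l"
    then have l: "l \<le> 0" by simp
    have nonneg: "0 \<le> impulse l m n" for n
    proof (induction n rule: less_induct)
      case (less n)
      show ?case
      proof (cases "n \<le> m")
        case True
        then show ?thesis by (cases "n = m") auto
      next
        case False
        then obtain k where n: "n = k + m + 1"
          by (metis add.assoc add.commute less_imp_Suc_add not_le Suc_eq_plus1)
        have "l * impulse l m k \<le> 0"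
          using less[of k] l by (intro mult_nonpos_nonneg) (auto simp: n)
        then show ?thesis
          using less[of "k + m"] unfolding n impulse_step by simp
      qed
    qed
    have ge1: "1 \<le> impulse l m (k + m)" for k
    proof (induction k)
      case (Suc k)
      then show ?case using impulse_step[of l m k] mult_nonpos_nonneg[OF l nonneg[of k]] by simp
    qed simp
    have "(\<lambda>k. impulse l m (k + m)) \<longlonglongrightarrow> 0"
      by (rule LIMSEQ_ignore_initial_segment[OF lim])
    then have "1 \<le> (0::real)"
      by (rule LIMSEQ_le_const) (use ge1 in auto)
    then show False by simp
  qed
  show "l < gain_bound m"
  proof (rule ccontr)
    assume "\<not> l < gain_bound m"
    then have "gain_bound m \<le> l" by simp
    then obtain z :: complex where z: "norm z \<ge> 1" "z ^ Suc m - z ^ m + of_real l = 0"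
      by (rule char_root_outside[OF m])
    have "z ^ (k + m + 1) = z ^ (k + m) - l *\<^sub>R z ^ k" for k
    proof -
      have "z ^ (k + m + 1) - z ^ (k + m) + l *\<^sub>R z ^ k
          = z ^ k * (z ^ Suc m - z ^ m + of_real l)"
        by (simp add: power_add algebra_simps scaleR_conv_of_real)
      also have "\<dots> = 0" by (simp only: z(2) mult_zero_right)
      finally show ?thesis by (simp only: diff_add_eq eq_diff_eq right_minus_eq)
    qed
    then have "(\<lambda>k. z ^ k) \<longlonglongrightarrow> 0"
      by (rule recurrence_tendsto_0) (rule lim)
    then have "(\<lambda>k. norm (z ^ k)) \<longlonglongrightarrow> 0"
      by (rule tendsto_norm_zero)
    then have "1 \<le> (0::real)"
      by (rule LIMSEQ_le_const) (use z(1) in \<open>auto simp: norm_power one_le_power\<close>)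
    then show False by simp
  qed
qed

text \<open>The zeros of the reversed polynomial are the inverses of the characteristic roots, and 0
  is not among them.\<close>

lemma summable_impulse_if_gain_range:
  assumes "0 < l" "l < gain_bound m"
  shows "summable (\<lambda>n. \<bar>impulse l m n\<bar>)"
proof (rule summable_impulse)
  fix z :: complex
  assume "norm z \<le> 1"
  show "1 - z + of_real l * z ^ Suc m \<noteq> 0"
  proof (cases "z = 0")
    case False
    then have "norm (inverse z) \<ge> 1"
      using \<open>norm z \<le> 1\<close> by (simp add: norm_inverse one_le_inverse)
    then have "inverse z ^ Suc m - inverse z ^ m + of_real l \<noteq> 0"
      by (intro char_root_inside assms)
    moreover have "z ^ Suc m * (inverse z ^ Suc m - inverse z ^ m + of_real l)
        = 1 - z + of_real l * z ^ Suc m"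
      using False by (simp add: field_simps)
    ultimately show ?thesis using False by auto
  qed simp
qed

subsection \<open>Symmetric matrices\<close>

lemma symmetric_matrix_inner:
  fixes K :: "real^'n^'n"
  assumes "transpose K = K"
  shows "x \<bullet> (K *v y) = (K *v x) \<bullet> y"
  by (metis assms dot_lmul_matrix transpose_matrix_vector)

text \<open>A maximiser \<open>u\<close> of the Rayleigh quotient on the unit sphere of the invariant
  subspace is an eigenvector: varying \<open>u\<close> in a direction \<open>y \<perp> u\<close> shows \<open>y \<perp> K u\<close>,
  and \<open>y = K u - (u \<bullet> K u) u\<close> is such a direction.\<close>

lemma symmetric_matrix_eigenvector:
  fixes K :: "real^'n^'n"
  assumes K: "transpose K = K" and S: "subspace S" and inv: "\<And>x. x \<in> S \<Longrightarrow> K *v x \<in> S"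
    and ne: "S \<noteq> {0}"
  obtains u m where "u \<in> S" "norm u = 1" "K *v u = m *\<^sub>R u"
proof -
  obtain x where x: "x \<in> S" "x \<noteq> 0"
    using ne subspace_0[OF S] by blast
  have "sgn x \<in> S" using x S by (simp add: sgn_div_norm subspace_scale)
  then have "sphere 0 1 \<inter> S \<noteq> {}"
    using x by (metis IntI empty_iff mem_sphere_0 norm_sgn)
  moreover have "compact (sphere 0 1 \<inter> S)"
    using S by (intro compact_Int_closed closed_subspace) auto
  moreover have "continuous_on (sphere 0 1 \<inter> S) (\<lambda>x. x \<bullet> (K *v x))"
    by (intro continuous_intros matrix_vector_mult_linear_continuous_on)
  ultimately obtain u where u: "u \<in> sphere 0 1 \<inter> S"
    and max: "\<And>y. y \<in> sphere 0 1 \<inter> S \<Longrightarrow> y \<bullet> (K *v y) \<le> u \<bullet> (K *v u)"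
    using continuous_attains_sup[of "sphere 0 1 \<inter> S" "\<lambda>x. x \<bullet> (K *v x)"] by blast
  define m where "m = u \<bullet> (K *v u)"
  have uu: "u \<bullet> u = 1" using u by (simp add: norm_eq_1)
  \<comment> \<open>Both sides are homogeneous of degree two, so the maximum over the sphere bounds
    the form on all of \<open>S\<close>.\<close>
  have bound: "y \<bullet> (K *v y) \<le> m * (y \<bullet> y)" if "y \<in> S" for y
  proof (cases "y = 0")
    case False
    then have "sgn y \<in> sphere 0 1 \<inter> S"
      using that S by (simp add: sgn_div_norm subspace_scale)
    from max[OF this] have "(y \<bullet> (K *v y)) / (norm y)\<^sup>2 \<le> m"
      by (simp add: sgn_div_norm m_def matrix_vector_mult_scaleR field_simps power2_eq_square)
    then show ?thesis
      using False by (simp add: field_simps power2_norm_eq_inner)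
  qed simp
  define y where "y = K *v u - m *\<^sub>R u"
  have "y \<in> S" using u S inv by (simp add: y_def subspace_diff subspace_scale)
  have yu: "y \<bullet> u = 0"
    by (simp add: y_def m_def inner_diff_left uu inner_commute[of "K *v u"])
  have yKu: "y \<bullet> (K *v u) = y \<bullet> y"
    using yu by (simp add: y_def inner_diff_right)
  define c where "c = \<bar>m * (y \<bullet> y) - y \<bullet> (K *v y)\<bar>"
  \<comment> \<open>Insert \<open>u + t y\<close> into \<open>bound\<close>: the constant terms
    cancel, and \<open>yKu\<close> turns the linear term into
    \<open>2 * t * (y \<bullet> y)\<close>.\<close>
  have quad: "2 * t * (y \<bullet> y) \<le> t\<^sup>2 * c" for t
  proof -
    let ?v = "u + t *\<^sub>R y"
    have "?v \<in> S" using u S \<open>y \<in> S\<close> by (simp add: subspace_add subspace_scale)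
    from bound[OF this] have "2 * t * (y \<bullet> y) \<le> t\<^sup>2 * (m * (y \<bullet> y) - y \<bullet> (K *v y))"
      using yKu yu uu symmetric_matrix_inner[OF K, of u y]
      by (simp add: matrix_vector_right_distrib matrix_vector_mult_scaleR inner_add_left
          inner_add_right inner_commute m_def[symmetric] algebra_simps power2_eq_square)
    also have "\<dots> \<le> t\<^sup>2 * c"
      by (intro mult_left_mono) (auto simp: c_def)
    finally show ?thesis .
  qed
  have "y \<bullet> y = 0"
  proof (rule ccontr)
    assume "y \<bullet> y \<noteq> 0"
    then have pos: "0 < y \<bullet> y" by simp
    have c: "0 < c + 1" by (simp add: c_def)
    \<comment> \<open>Small enough for the linear term to beat the quadratic one; the
      \<open>+ 1\<close> covers \<open>c = 0\<close>.\<close>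
    define t where "t = (y \<bullet> y) / (c + 1)"
    have t: "0 < t" using pos c by (simp add: t_def)
    have "t * (2 * (y \<bullet> y)) \<le> t * (t * c)"
      using quad[of t] by (simp add: power2_eq_square algebra_simps)
    then have "2 * (y \<bullet> y) \<le> t * c" using t by simp
    also have "\<dots> \<le> t * (c + 1)" using t by (intro mult_left_mono) auto
    also have "\<dots> = y \<bullet> y" using c by (simp add: t_def)
    finally show False using pos by simp
  qed
  then have "K *v u = m *\<^sub>R u" by (simp add: y_def)
  with u show thesis using that by auto
qed

text \<open>Deflation by induction on the dimension: after splitting off one eigenvector
  \<open>u\<close>, symmetry keeps the part of \<open>S\<close> orthogonal to \<open>u\<close>
  invariant.\<close>

lemma symmetric_matrix_eigenbasis:
  fixes K :: "real^'n^'n"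
  assumes K: "transpose K = K" and S: "subspace S" and inv: "\<And>x. x \<in> S \<Longrightarrow> K *v x \<in> S"
  obtains B where "B \<subseteq> S" "finite B" "pairwise orthogonal B" "\<And>b. b \<in> B \<Longrightarrow> norm b = 1"
    "span B = S" "\<And>b. b \<in> B \<Longrightarrow> \<exists>m. K *v b = m *\<^sub>R b"
proof -
  have "\<exists>B \<subseteq> S. finite B \<and> pairwise orthogonal B \<and> (\<forall>b\<in>B. norm b = 1) \<and> span B = S
      \<and> (\<forall>b\<in>B. \<exists>m. K *v b = m *\<^sub>R b)"
    using S inv
  proof (induction "dim S" arbitrary: S rule: less_induct)
    case less
    show ?case
    proof (cases "S = {0}")
      case True
      then show ?thesis by (intro exI[of _ "{}"]) (auto simp: pairwise_def)
    next
      case False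
      obtain u m where u: "u \<in> S" "norm u = 1" "K *v u = m *\<^sub>R u"
        using symmetric_matrix_eigenvector[OF K less.prems False] by blast
      define T where "T = {x \<in> S. u \<bullet> x = 0}"
      have "subspace T"
        using less.prems(1) by (auto simp: T_def subspace_def inner_add_right)
      moreover have "K *v x \<in> T" if "x \<in> T" for x
        using that less.prems(2) u(3) symmetric_matrix_inner[OF K, of u x] by (auto simp: T_def)
      moreover have "dim T < dim S"
      proof (rule dim_psubset)
        have "u \<notin> T" using u by (auto simp: T_def norm_eq_1)
        then have "T \<subset> S" using u(1) unfolding T_def by blast
        then show "span T \<subset> span S"
          using \<open>subspace T\<close> less.prems(1) by (metis span_eq_iff)
      qed
      ultimately obtain B where B: "B \<subseteq> T" "finite B" "pairwise orthogonal B"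
        "\<forall>b\<in>B. norm b = 1" "span B = T" "\<forall>b\<in>B. \<exists>m. K *v b = m *\<^sub>R b"
        using less.hyps[of T] by blast
      have "span (insert u B) = S"
      proof
        show "span (insert u B) \<subseteq> S"
          using u B less.prems(1) by (intro span_minimal) (auto simp: T_def)
        show "S \<subseteq> span (insert u B)"
        proof
          fix x assume "x \<in> S"
          then have "x - (u \<bullet> x) *\<^sub>R u \<in> T"
            using u less.prems(1)
            by (auto simp: T_def subspace_diff subspace_scale inner_diff_right norm_eq_1)
          then show "x \<in> span (insert u B)"
            using B(5) by (auto simp: span_breakdown_eq)
        qed
      qed
      moreover have "pairwise orthogonal (insert u B)"
        using B(1,3) by (auto simp: pairwise_insert orthogonal_def T_def inner_commute)
      ultimately show ?thesis
        using u B by (intro exI[of _ "insert u B"]) (auto simp: T_def)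
    qed
  qed
  then show thesis using that by blast
qed

lemma norm_orthonormal_expansion:
  fixes x :: "'v::euclidean_space"
  assumes "finite B" "pairwise orthogonal B" "\<And>b. b \<in> B \<Longrightarrow> norm b = 1" "x \<in> span B"
  shows "(norm x)\<^sup>2 = (\<Sum>b\<in>B. (b \<bullet> x)\<^sup>2)"
proof -
  have *: "b \<bullet> c = (if b = c then 1 else 0)" if "b \<in> B" "c \<in> B" for b c
    using assms(2,3) that by (auto simp: pairwise_def orthogonal_def norm_eq_1)
  obtain f where f: "x = (\<Sum>b\<in>B. f b *\<^sub>R b)"
    using assms(1,4) by (auto simp: span_finite)
  have "b \<bullet> x = f b" if "b \<in> B" for b
    using that assms(1) by (simp add: f inner_sum_right * if_distrib cong: if_cong)
  then have "x \<bullet> x = (\<Sum>b\<in>B. (b \<bullet> x) * (b \<bullet> x))"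
    by (subst (1) f) (simp add: inner_sum_left)
  then show ?thesis
    by (simp add: dot_square_norm power2_eq_square)
qed

text \<open>With the basis as columns of an orthogonal \<open>Q\<close>, comparing columns gives
  \<open>(mat t - K) ** Q = Q ** D\<close> for a diagonal \<open>D\<close>, and \<open>det Q\<close>
  cancels.\<close>

lemma det_mat_minus_orthonormal_eigenbasis:
  fixes K :: "real^'n^'n"
  assumes B: "pairwise orthogonal B" "\<And>b. b \<in> B \<Longrightarrow> norm b = 1" "card B = CARD('n)"
    and eig: "\<And>b. b \<in> B \<Longrightarrow> K *v b = m b *\<^sub>R b"
  shows "det (mat t - K) = (\<Prod>b\<in>B. t - m b)"
proof -
  have "finite B" using B(3) by (intro card_ge_0_finite) simp
  then obtain f where f: "bij_betw f (UNIV :: 'n set) B"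
    using B(3) by (metis finite_same_card_bij finite)
  have fB: "f i \<in> B" for i using f by (auto simp: bij_betw_def)
  define Q :: "real^'n^'n" where "Q = (\<chi> i j. f j $ i)"
  have col: "column j Q = f j" for j
    by (simp add: Q_def column_def vec_eq_iff)
  have "orthogonal_matrix Q"
    unfolding orthogonal_matrix_orthonormal_columns col
  proof (intro conjI allI impI)
    fix i j :: 'n assume "i \<noteq> j"
    then have "f i \<noteq> f j" using f by (auto simp: bij_betw_def inj_def)
    then show "orthogonal (f i) (f j)" using B(1) fB by (auto simp: pairwise_def)
  qed (use B fB in auto)
  then have "det Q \<noteq> 0" using det_orthogonal_matrix by fastforce
  define D :: "real^'n^'n" where "D = (\<chi> i j. if i = j then t - m (f i) else 0)"
  have "(mat t - K) ** Q = Q ** D"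
  proof -
    have "((mat t - K) ** Q) *v axis j 1 = (Q ** D) *v axis j 1" for j
    proof -
      have "D *v axis j 1 = (t - m (f j)) *\<^sub>R axis j 1"
        unfolding matrix_vector_mult_basis
        by (simp add: vec_eq_iff column_def D_def axis_def)
      moreover have "mat t *v x = t *\<^sub>R x" for x :: "real^'n"
        by (simp add: matrix_vector_mult_def mat_def vec_eq_iff if_distrib if_distribR cong: if_cong)
      moreover have "Q *v axis j 1 = f j"
        by (simp only: matrix_vector_mult_basis col)
      ultimately show ?thesis
        by (simp only: matrix_vector_mul_assoc[symmetric] matrix_vector_mult_scaleR
            matrix_vector_mult_diff_rdistrib matrix_vector_mult_diff_distrib eig[OF fB] scaleR_diff_left)
    qed
    then show ?thesis
      unfolding matrix_vector_mult_basis by (simp add: vec_eq_iff column_def)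
  qed
  then have "det (mat t - K) * det Q = det Q * det D"
    by (metis det_mul)
  then have "det (mat t - K) = det D" using \<open>det Q \<noteq> 0\<close> by simp
  also have "\<dots> = (\<Prod>i\<in>UNIV. t - m (f i))"
    by (subst det_diagonal) (auto simp: D_def)
  also have "\<dots> = (\<Prod>b\<in>B. t - m b)"
    by (rule prod.reindex_bij_betw[OF f])
  finally show ?thesis .
qed

text \<open>The common factor \<open>t\<close> stands for the eigenvalue 0 of the all-ones vector.
  It is cancelled between polynomials, since pointwise cancellation fails at \<open>t = 0\<close>.
  Root sets suffice because the stability condition constrains each eigenvalue separately.\<close>

lemma monic_roots_unique:
  fixes f :: "'i \<Rightarrow> real" and g :: "'j \<Rightarrow> real"
  assumes fin: "finite I" "finite J"
    and eq: "\<And>t. t * (\<Prod>i\<in>I. t - f i) = t * (\<Prod>j\<in>J. t - g j)"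
  shows "f ` I = g ` J"
proof -
  define p q where "p = (\<Prod>i\<in>I. [:- f i, 1:])" and "q = (\<Prod>j\<in>J. [:- g j, 1:])"
  have "poly ([:0, 1:] * p) t = poly ([:0, 1:] * q) t" for t
    using eq[of t] by (simp add: p_def q_def poly_prod)
  then have "[:0, 1:] * p = [:0, 1:] * q"
    by (metis poly_eq_poly_eq_iff ext)
  then have "p = q" by simp
  moreover have "f ` I = {t. poly p t = 0}" "g ` J = {t. poly q t = 0}"
    using fin by (auto simp: p_def q_def poly_prod)
  ultimately show ?thesis by simp
qed

subsection \<open>Modes of the network error\<close>

lemma (in prob_space)
  fixes X :: "'i \<Rightarrow> 'a \<Rightarrow> real"
  assumes "indep_vars (\<lambda>_. borel) X I" "i \<in> I" "j \<in> I" "i \<noteq> j"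
    and "integrable M (X i)" "integrable M (X j)"
  shows integrable_indep_vars_mult: "integrable M (\<lambda>\<omega>. X i \<omega> * X j \<omega>)"
    and expectation_indep_vars_mult:
      "expectation (\<lambda>\<omega>. X i \<omega> * X j \<omega>) = expectation (X i) * expectation (X j)"
proof -
  have "indep_vars (\<lambda>_. borel) X {i, j}"
    by (rule indep_vars_subset[OF assms(1)]) (use assms in auto)
  note * = indep_vars_integrable[OF _ this] indep_vars_lebesgue_integral[OF _ this]
  show "integrable M (\<lambda>\<omega>. X i \<omega> * X j \<omega>)"
    "expectation (\<lambda>\<omega>. X i \<omega> * X j \<omega>) = expectation (X i) * expectation (X j)"
    using * assms by auto
qed

lemma (in prob_space)
  assumes D: "distributed M lborel X std_normal_density"
  shows integrable_std_normal: "integrable M X"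
    and integrable_std_normal_square: "integrable M (\<lambda>\<omega>. (X \<omega>)\<^sup>2)"
    and expectation_std_normal_square: "expectation (\<lambda>\<omega>. (X \<omega>)\<^sup>2) = 1"
proof -
  show "integrable M X"
    using integrable_std_normal_moment[of 1]
    by (intro distributed_integrable_var[OF D]) simp_all
  show "integrable M (\<lambda>\<omega>. (X \<omega>)\<^sup>2)"
    using integrable_std_normal_moment[of 2] distributed_integrable[OF D, of "\<lambda>x. x\<^sup>2"]
    by simp
  show "expectation (\<lambda>\<omega>. (X \<omega>)\<^sup>2) = 1"
    using standard_normal_distributed_variance[OF D] standard_normal_distributed_expectation[OF D]
    by simp
qed

text \<open>The coordinates are uncorrelated with mean 0 and variance 1, so only the diagonal of the
  expanded square survives.\<close>

lemma (in prob_space)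
  fixes v :: "real^'n"
  assumes G: "standard_gaussian_vector M X"
  shows integrable_gaussian_inner: "integrable M (\<lambda>\<omega>. v \<bullet> X \<omega>)"
    and expectation_gaussian_inner: "expectation (\<lambda>\<omega>. v \<bullet> X \<omega>) = 0"
    and integrable_gaussian_inner_square: "integrable M (\<lambda>\<omega>. (v \<bullet> X \<omega>)\<^sup>2)"
    and expectation_gaussian_inner_square: "expectation (\<lambda>\<omega>. (v \<bullet> X \<omega>)\<^sup>2) = v \<bullet> v"
proof -
  have ind: "indep_vars (\<lambda>_. borel) (\<lambda>i \<omega>. X \<omega> $ i) UNIV"
    and D: "distributed M lborel (\<lambda>\<omega>. X \<omega> $ i) std_normal_density" for i
    using G by (auto simp: standard_gaussian_vector_def)
  note int = integrable_std_normal[OF D]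
  note E = standard_normal_distributed_expectation[OF D]
  have int2: "integrable M (\<lambda>\<omega>. X \<omega> $ i * X \<omega> $ j)" for i j
    using integrable_indep_vars_mult[OF ind, of i j] integrable_std_normal_square[OF D, of i] int
    by (cases "i = j") (auto simp: power2_eq_square)
  have E2: "expectation (\<lambda>\<omega>. X \<omega> $ i * X \<omega> $ j) = (if i = j then 1 else 0)" for i j
    using expectation_indep_vars_mult[OF ind, of i j] expectation_std_normal_square[OF D, of i] int E
    by (cases "i = j") (auto simp: power2_eq_square)
  have lin: "v \<bullet> X \<omega> = (\<Sum>i\<in>UNIV. v $ i * X \<omega> $ i)" for \<omega>
    by (simp add: inner_vec_def)
  have quad: "(v \<bullet> X \<omega>)\<^sup>2 = (\<Sum>i\<in>UNIV. \<Sum>j\<in>UNIV. (v $ i * v $ j) * (X \<omega> $ i * X \<omega> $ j))" for \<omega>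
    by (simp add: lin power2_eq_square sum_product ac_simps)
  show "integrable M (\<lambda>\<omega>. v \<bullet> X \<omega>)"
    unfolding lin by (intro Bochner_Integration.integrable_sum integrable_mult_right int)
  show "expectation (\<lambda>\<omega>. v \<bullet> X \<omega>) = 0"
    unfolding lin by (subst Bochner_Integration.integral_sum) (auto simp: int E)
  show "integrable M (\<lambda>\<omega>. (v \<bullet> X \<omega>)\<^sup>2)"
    unfolding quad by (intro Bochner_Integration.integrable_sum integrable_mult_right int2)
  have "expectation (\<lambda>\<omega>. (v \<bullet> X \<omega>)\<^sup>2)
      = (\<Sum>i\<in>UNIV. \<Sum>j\<in>UNIV. (v $ i * v $ j) * expectation (\<lambda>\<omega>. X \<omega> $ i * X \<omega> $ j))"
    unfolding quad
    by (subst Bochner_Integration.integral_sum;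
        (intro Bochner_Integration.integrable_sum integrable_mult_right int2)?)
      (intro sum.cong refl, subst Bochner_Integration.integral_sum; simp add: int2)
  then show "expectation (\<lambda>\<omega>. (v \<bullet> X \<omega>)\<^sup>2) = v \<bullet> v"
    by (simp add: E2 inner_vec_def if_distrib cong: if_cong)
qed

text \<open>In the expanded square, zero means remove the terms linear in the noise and
  orthonormality removes the off-diagonal products.\<close>

lemma (in prob_space)
  fixes X :: "nat \<Rightarrow> 'a \<Rightarrow> real"
  assumes int: "\<And>i. integrable M (X i)" and E: "\<And>i. expectation (X i) = 0"
    and int2: "\<And>i j. integrable M (\<lambda>\<omega>. X i \<omega> * X j \<omega>)"
    and E2: "\<And>i j. expectation (\<lambda>\<omega>. X i \<omega> * X j \<omega>) = (if i = j then 1 else 0)"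
  shows integrable_white_noise_square:
      "integrable M (\<lambda>\<omega>. (d + (\<Sum>i<k. c i * X i \<omega>))\<^sup>2)" (is ?int)
    and expectation_white_noise_square:
      "expectation (\<lambda>\<omega>. (d + (\<Sum>i<k. c i * X i \<omega>))\<^sup>2) = d\<^sup>2 + (\<Sum>i<k. (c i)\<^sup>2)" (is ?E)
proof -
  define L where "L \<omega> = (\<Sum>i<k. 2 * d * c i * X i \<omega>)" for \<omega>
  define Q where "Q \<omega> = (\<Sum>i<k. \<Sum>j<k. (c i * c j) * (X i \<omega> * X j \<omega>))" for \<omega>
  have exp: "(d + (\<Sum>i<k. c i * X i \<omega>))\<^sup>2 = d\<^sup>2 + L \<omega> + Q \<omega>" for \<omega>
    unfolding L_def Q_def power2_sum
    by (simp add: power2_eq_square sum_product sum_distrib_left ac_simps)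
  have L: "integrable M L" "expectation L = 0"
    unfolding L_def using int E by auto
  have Q: "integrable M Q"
    unfolding Q_def by (intro Bochner_Integration.integrable_sum integrable_mult_right int2)
  have "expectation Q = (\<Sum>i<k. \<Sum>j<k. (c i * c j) * expectation (\<lambda>\<omega>. X i \<omega> * X j \<omega>))"
    unfolding Q_def
    by (subst Bochner_Integration.integral_sum;
        (intro Bochner_Integration.integrable_sum integrable_mult_right int2)?)
      (intro sum.cong refl, subst Bochner_Integration.integral_sum; simp add: int2)
  also have "\<dots> = (\<Sum>i<k. (c i)\<^sup>2)"
    by (simp add: E2 power2_eq_square if_distrib cong: if_cong)
  finally have EQ: "expectation Q = (\<Sum>i<k. (c i)\<^sup>2)" .
  show ?int unfolding exp using L Q by simp
  show ?E unfolding exp using L Q EQ by (simp add: prob_space)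
qed

section \<open>Projecting the trajectory onto eigenvectors\<close>

lemma Omega_vector: "Omega *v (x :: real^'n) = x - ((1 \<bullet> x) / CARD('n)) *\<^sub>R 1"
proof -
  have "((\<chi> i j. 1) :: real^'n^'n) *v x = (1 \<bullet> x) *\<^sub>R 1"
    by (simp add: matrix_vector_mult_def inner_vec_def vec_eq_iff)
  then show ?thesis
    by (simp add: Omega_def matrix_vector_mult_diff_rdistrib flip: scaleR_matrix_vector_assoc)
qed

text \<open>Symmetry moves \<open>K\<close> onto \<open>v\<close>, where it acts as
  \<open>l\<close>, and \<open>Omega\<close> alters the noise only along the all-ones vector, which
  is orthogonal to \<open>v\<close>.\<close>

lemma net_error_mode_step:
  fixes K :: "real^'n^'n"
  assumes "transpose K = K" "K *v v = l *\<^sub>R v" "1 \<bullet> v = 0"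
  shows "v \<bullet> net_error K tau w h (int k + 1) \<omega> =
      v \<bullet> net_error K tau w h (int k) \<omega> - l * (v \<bullet> net_error K tau w h (int k - int tau) \<omega>)
      + v \<bullet> w k \<omega>"
  using assms(2,3)
  by (simp add: net_error_step inner_add_right inner_diff_right symmetric_matrix_inner[OF assms(1)]
      Omega_vector inner_commute[of v 1])

text \<open>The index \<open>n\<close> again stands for the time \<open>n - tau\<close>.\<close>

definition free_mode :: "real^'n^'n \<Rightarrow> nat \<Rightarrow> (int \<Rightarrow> real^'n) \<Rightarrow> real^'n \<Rightarrow> nat \<Rightarrow> real" where
  "free_mode K tau h v n = v \<bullet> net_error K tau (\<lambda>_ _. 0) h (int n - int tau) ()"

text \<open>The mode step with zero noise on a one-point sample space, written with scalar
  multiplication to fit \<open>recurrence_tendsto_0\<close>.\<close>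

lemma free_mode_recurrence:
  fixes K :: "real^'n^'n"
  assumes "transpose K = K" "K *v v = l *\<^sub>R v" "1 \<bullet> v = 0"
  shows "free_mode K tau h v (k + tau + 1) = free_mode K tau h v (k + tau) - l *\<^sub>R free_mode K tau h v k"
proof -
  have "int (k + tau + 1) - int tau = int k + 1" "int (k + tau) - int tau = int k" by simp_all
  then show ?thesis
    using net_error_mode_step[OF assms, of tau "\<lambda>_ _. 0" h k "()"]
    unfolding free_mode_def by (simp only: real_scaleR_def inner_zero_right add_0_right)
qed

text \<open>Superposition: the deviation \<open>Y\<close> from the free response and the noise
  convolution \<open>N\<close> obey the same driven recursion and both vanish up to index
  \<open>tau\<close>.\<close>

lemma net_error_mode:
  fixes K :: "real^'n^'n"
  assumes "transpose K = K" "K *v v = l *\<^sub>R v" "1 \<bullet> v = 0"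
  shows "v \<bullet> net_error K tau w h (int k) \<omega> = free_mode K tau h v (k + tau)
      + (\<Sum>i<k. impulse l tau (k - Suc i + tau) * (v \<bullet> w i \<omega>))"
proof -
  define Y where "Y n = v \<bullet> net_error K tau w h (int n - int tau) \<omega> - free_mode K tau h v n" for n
  define N where "N n = (\<Sum>i<n - tau. impulse l tau (n - Suc i) * (v \<bullet> w i \<omega>))" for n
  have Y_step: "Y (k + tau + 1) = Y (k + tau) - l * Y k + v \<bullet> w k \<omega>" for k
    using net_error_mode_step[OF assms, of tau w h k \<omega>] free_mode_recurrence[OF assms, of tau h k]
    by (simp add: Y_def algebra_simps)
  have N_step: "N (k + tau + 1) = N (k + tau) - l * N k + v \<bullet> w k \<omega>" for k
  proof -
    \<comment> \<open>The range may grow to \<open>i < k\<close>, because each added term has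
      \<open>k - Suc i < tau\<close>, where the impulse response is 0.\<close>
    have "N k = (\<Sum>i<k. impulse l tau (k - Suc i) * (v \<bullet> w i \<omega>))"
      unfolding N_def by (rule sum.mono_neutral_left) auto
    \<comment> \<open>The recursion of \<open>impulse\<close>, term by term. The remaining summand
      \<open>i = k\<close> of \<open>N (k + tau + 1)\<close> has coefficient
      \<open>impulse l tau tau = 1\<close> and supplies the new noise.\<close>
    moreover have "impulse l tau (k + tau - i) =
        impulse l tau (k + tau - Suc i) - l * impulse l tau (k - Suc i)" if "i < k" for i
      using impulse_step[of l tau "k - Suc i"] that by (simp add: Suc_diff_Suc)
    then have "(\<Sum>i<k. impulse l tau (k + tau - i) * (v \<bullet> w i \<omega>))
        = (\<Sum>i<k. impulse l tau (k + tau - Suc i) * (v \<bullet> w i \<omega>))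
          - l * (\<Sum>i<k. impulse l tau (k - Suc i) * (v \<bullet> w i \<omega>))"
      by (simp add: left_diff_distrib sum_subtractf sum_distrib_left mult.assoc)
    ultimately show ?thesis
      by (simp add: N_def)
  qed
  have "Y n = N n" for n
  proof (induction n rule: less_induct)
    case (less n)
    show ?case
    proof (cases "n \<le> tau")
      case True
      then show ?thesis by (simp add: Y_def N_def free_mode_def net_error_initial)
    next
      case False
      then obtain k where n: "n = k + tau + 1"
        by (metis add.assoc add.commute less_imp_Suc_add not_le Suc_eq_plus1)
      show ?thesis
        using less[of k] less[of "k + tau"] unfolding n Y_step N_step by simp
    qed
  qed
  from this[of "k + tau"] have "Y (k + tau) = (\<Sum>i<k. impulse l tau (k - Suc i + tau) * (v \<bullet> w i \<omega>))"
    by (simp add: N_def)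
  then show ?thesis by (simp add: Y_def)
qed

text \<open>Projected onto a unit vector, the noise is again white with unit variance. Reversing the
  convolution index turns its contribution into partial sums of one fixed series.\<close>

lemma mode_second_moment:
  fixes K :: "real^'n^'n"
  assumes "prob_space M" and ind: "prob_space.indep_vars M (\<lambda>_. borel) w UNIV"
    and G: "\<And>k. standard_gaussian_vector M (w k)"
    and v: "transpose K = K" "K *v v = l *\<^sub>R v" "1 \<bullet> v = 0" "norm v = 1"
  shows "integrable M (\<lambda>\<omega>. (v \<bullet> net_error K tau w h (int k) \<omega>)\<^sup>2)" (is ?int)
    and "prob_space.expectation M (\<lambda>\<omega>. (v \<bullet> net_error K tau w h (int k) \<omega>)\<^sup>2)
      = (free_mode K tau h v (k + tau))\<^sup>2 + (\<Sum>i<k. (impulse l tau (i + tau))\<^sup>2)" (is ?E)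
proof -
  interpret prob_space M by fact
  define X where "X i \<omega> = v \<bullet> w i \<omega>" for i \<omega>
  have int: "integrable M (X i)" and E: "expectation (X i) = 0" for i
    unfolding X_def by (rule integrable_gaussian_inner[OF G] expectation_gaussian_inner[OF G])+
  have indX: "indep_vars (\<lambda>_. borel) X UNIV"
    unfolding X_def using indep_vars_compose2[OF ind, of "\<lambda>_ x. v \<bullet> x" "\<lambda>_. borel"] by simp
  have int2: "integrable M (\<lambda>\<omega>. X i \<omega> * X j \<omega>)" for i j
    using integrable_indep_vars_mult[OF indX, of i j] integrable_gaussian_inner_square[OF G, of v i] int
    by (cases "i = j") (auto simp: power2_eq_square X_def)
  have E2: "expectation (\<lambda>\<omega>. X i \<omega> * X j \<omega>) = (if i = j then 1 else 0)" for i j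
    using expectation_indep_vars_mult[OF indX, of i j] int E v(4)
      expectation_gaussian_inner_square[OF G, of v i]
    by (cases "i = j") (auto simp: power2_eq_square X_def norm_eq_1)
  note mode = net_error_mode[OF v(1-3), where w = w, folded X_def]
  show ?int
    unfolding mode by (rule integrable_white_noise_square[OF int E int2 E2])
  have "expectation (\<lambda>\<omega>. (v \<bullet> net_error K tau w h (int k) \<omega>)\<^sup>2)
      = (free_mode K tau h v (k + tau))\<^sup>2 + (\<Sum>i<k. (impulse l tau (k - Suc i + tau))\<^sup>2)"
    unfolding mode by (rule expectation_white_noise_square[OF int E int2 E2])
  also have "(\<Sum>i<k. (impulse l tau (k - Suc i + tau))\<^sup>2) = (\<Sum>i<k. (impulse l tau (i + tau))\<^sup>2)"
    by (rule sum.nat_diff_reindex[of "\<lambda>i. (impulse l tau (i + tau))\<^sup>2"])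
  finally show ?E .
qed

text \<open>Adding the normalised all-ones vector \<open>e\<close> to an eigenbasis of its
  complement gives an orthonormal eigenbasis of the whole space. The characteristic polynomial is
  then \<open>t\<close> times the product over \<open>B\<close>, to be compared with the given
  list.\<close>

lemma network_eigenbasis:
  fixes K :: "real^'n^'n"
  assumes K: "transpose K = K" "K *v 1 = 0" and lam: "eigenvalue_list K lam" "lam 1 = 0"
  obtains B where "finite B" "pairwise orthogonal B" "\<And>b. b \<in> B \<Longrightarrow> norm b = 1"
    "span B = {x. 1 \<bullet> x = 0}" "\<And>b. b \<in> B \<Longrightarrow> K *v b = (b \<bullet> (K *v b)) *\<^sub>R b"
    "lam ` {2..CARD('n)} = (\<lambda>b. b \<bullet> (K *v b)) ` B"
proof -
  define S :: "(real^'n) set" where "S = {x. 1 \<bullet> x = 0}"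
  have S: "subspace S" by (auto simp: S_def subspace_def inner_add_right)
  have "K *v x \<in> S" for x
    using symmetric_matrix_inner[OF K(1), of 1 x] K(2) by (simp add: S_def)
  then obtain B where B: "B \<subseteq> S" "finite B" "pairwise orthogonal B" "\<And>b. b \<in> B \<Longrightarrow> norm b = 1"
    "span B = S" and eigB: "\<And>b. b \<in> B \<Longrightarrow> \<exists>m. K *v b = m *\<^sub>R b"
    using symmetric_matrix_eigenbasis[OF K(1) S] by blast
  define m where "m b = b \<bullet> (K *v b)" for b
  have eig: "K *v b = m b *\<^sub>R b" if "b \<in> B" for b
    using eigB[OF that] B(4)[OF that] by (auto simp: m_def norm_eq_1)
  define e :: "real^'n" where "e = sgn 1"
  have "K *v e = 0" using K(2) by (simp add: e_def sgn_div_norm matrix_vector_mult_scaleR)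
  moreover have "norm e = 1" by (simp add: e_def norm_sgn)
  ultimately have e: "norm e = 1" "e \<bullet> e = 1" "K *v e = 0" "m e = 0"
    by (simp_all add: m_def norm_eq_1)
  have eB: "e \<bullet> b = 0" if "b \<in> S" for b
    using that by (simp add: e_def S_def sgn_div_norm)
  have "e \<notin> B" using eB e(2) B(1) by force
  have eS: "x \<in> S" if "e \<bullet> x = 0" for x
    using that by (simp add: e_def S_def sgn_div_norm)
  have orth: "pairwise orthogonal (insert e B)"
    using B(1,3) eB by (auto simp: pairwise_insert orthogonal_def inner_commute)
  have "0 \<notin> insert e B" using B(4) e(1) by force
  with orth have "independent (insert e B)" by (rule pairwise_orthogonal_independent)
  moreover have "x \<in> span (insert e B)" for x
  proof -
    have "x - (e \<bullet> x) *\<^sub>R e \<in> S" by (rule eS) (simp add: inner_diff_right e)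
    then show ?thesis using B(5) by (auto simp: span_breakdown_eq)
  qed
  then have "span (insert e B) = UNIV" by auto
  ultimately have "card (insert e B) = CARD('n)"
    using dim_span_eq_card_independent[of "insert e B"] by simp
  then have "det (mat t - K) = (\<Prod>b\<in>insert e B. t - m b)" for t
    using orth B(4) e eig by (intro det_mat_minus_orthonormal_eigenbasis) auto
  then have det: "det (mat t - K) = t * (\<Prod>b\<in>B. t - m b)" for t
    using B(2) \<open>e \<notin> B\<close> e(4) by simp
  have "t * (\<Prod>j\<in>{2..CARD('n)}. t - lam j) = t * (\<Prod>b\<in>B. t - m b)" for t
  proof -
    \<comment> \<open>Splitting off \<open>j = 1\<close>, where \<open>lam 1 = 0\<close>, produces
      the same factor \<open>t\<close> as the vector \<open>e\<close> does.\<close>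
    have "{1..CARD('n)} = insert 1 {2..CARD('n)}" by (auto simp: Suc_le_eq)
    then have "(\<Prod>j = 1..CARD('n). t - lam j) = t * (\<Prod>j\<in>{2..CARD('n)}. t - lam j)"
      using lam(2) by simp
    then show ?thesis using lam(1) det unfolding eigenvalue_list_def by metis
  qed
  then have "lam ` {2..CARD('n)} = m ` B"
    using B(2) by (intro monic_roots_unique) auto
  with B eig show thesis
    using that unfolding S_def m_def by blast
qed

lemma summable_square_if_abs_summable:
  fixes f :: "nat \<Rightarrow> real"
  assumes "summable (\<lambda>n. \<bar>f n\<bar>)"
  shows "summable (\<lambda>n. (f n)\<^sup>2)"
proof (rule summable_comparison_test_ev[OF _ assms])
  have "eventually (\<lambda>n. \<bar>f n\<bar> < 1) sequentially"
    using summable_LIMSEQ_zero[OF assms] by (rule order_tendstoD) simp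
  then show "eventually (\<lambda>n. norm ((f n)\<^sup>2) \<le> \<bar>f n\<bar>) sequentially"
  proof eventually_elim
    case (elim n)
    then have "\<bar>f n\<bar> * \<bar>f n\<bar> \<le> 1 * \<bar>f n\<bar>" by (intro mult_right_mono) auto
    then show ?case by (simp add: power2_eq_square)
  qed
qed

theorem proposition4:
  fixes M :: "'a measure"
    and K :: "real^'n^'n"
    and tau :: nat
    and lam :: "nat \<Rightarrow> real"
    and w :: "nat \<Rightarrow> 'a \<Rightarrow> real^'n"
  assumes "CARD('n) \<ge> 2"
    and "tau \<ge> 1"
    and "transpose K = K"
    and "K *v 1 = 0"
    and "eigenvalue_list K lam"
    and "lam 1 = 0"
    and "prob_space M"
    and "prob_space.indep_vars M (\<lambda>_. borel) w UNIV"
    and "\<And>k. standard_gaussian_vector M (w k)"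
  shows "mean_square_stable M K tau w \<longleftrightarrow>
    (\<forall>j \<in> {2..CARD('n)}. lam j \<in> {0 <..< 2 * sin (pi / 2 * (1 / (2 * real tau + 1)))})"
proof -
  obtain B where B: "finite B" "pairwise orthogonal B" "\<And>b. b \<in> B \<Longrightarrow> norm b = 1"
    "span B = {x. 1 \<bullet> x = 0}" "\<And>b. b \<in> B \<Longrightarrow> K *v b = (b \<bullet> (K *v b)) *\<^sub>R b"
    and lam_B: "lam ` {2..CARD('n)} = (\<lambda>b. b \<bullet> (K *v b)) ` B"
    using network_eigenbasis[OF assms(3-6)] by blast
  define m where "m b = b \<bullet> (K *v b)" for b
  have eig: "K *v b = m b *\<^sub>R b" "1 \<bullet> b = 0" if "b \<in> B" for b
    using B(4,5) that span_base by (auto simp: m_def)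
  note moment = mode_second_moment[OF assms(7-9,3) eig B(3)]
  \<comment> \<open>The explicit second moment: per mode, the squared free response plus the
    accumulated noise energy.\<close>
  define E where "E h k = (\<Sum>b\<in>B. (free_mode K tau h b (k + tau))\<^sup>2
      + (\<Sum>i<k. (impulse (m b) tau (i + tau))\<^sup>2))" for h k
  have stable_iff: "mean_square_stable M K tau w \<longleftrightarrow>
      (\<forall>h. (\<forall>s \<in> {- int tau..0}. 1 \<bullet> h s = 0) \<longrightarrow> convergent (E h))"
  proof -
    have norm_eq: "(norm (net_error K tau w h (int k) \<omega>))\<^sup>2
        = (\<Sum>b\<in>B. (b \<bullet> net_error K tau w h (int k) \<omega>)\<^sup>2)"
      if "\<forall>s \<in> {- int tau..0}. 1 \<bullet> h s = 0" for h k \<omega>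
      using inner_one_net_error[OF assms(3,4) that, of "int k"]
      by (intro norm_orthonormal_expansion B) (auto simp: B(4))
    have "integrable M (\<lambda>\<omega>. (norm (net_error K tau w h (int k) \<omega>))\<^sup>2)"
      and "prob_space.expectation M (\<lambda>\<omega>. (norm (net_error K tau w h (int k) \<omega>))\<^sup>2) = E h k"
      if "\<forall>s \<in> {- int tau..0}. 1 \<bullet> h s = 0" for h k
      unfolding norm_eq[OF that] E_def
      using moment by (auto simp: Bochner_Integration.integral_sum)
    then show ?thesis
      unfolding mean_square_stable_def by (simp cong: conj_cong)
  qed
  have free: "free_mode K tau h b (k + tau + 1)
      = free_mode K tau h b (k + tau) - m b *\<^sub>R free_mode K tau h b k" if "b \<in> B" for h b k
    by (rule free_mode_recurrence[OF assms(3) eig[OF that]])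
  have "mean_square_stable M K tau w \<longleftrightarrow> (\<forall>b\<in>B. m b \<in> {0<..<gain_bound tau})"
    unfolding stable_iff
  proof (intro iffI ballI allI impI)
    fix b assume stable: "\<forall>h. (\<forall>s \<in> {- int tau..0}. 1 \<bullet> h s = 0) \<longrightarrow> convergent (E h)"
      and b: "b \<in> B"
    define p where "p n = (impulse (m b) tau (n + tau))\<^sup>2" for n
    \<comment> \<open>One admissible history is enough for necessity. A convergent sequence is
      bounded, and all summands of \<open>E\<close> are nonnegative, so the noise energy of each
      single mode is bounded.\<close>
    have "convergent (E (\<lambda>_. 0))" using stable by simp
    then obtain C where C: "\<And>k. \<bar>E (\<lambda>_. 0) k\<bar> \<le> C"
      by (metis Bseq_def convergent_imp_Bseq real_norm_def)
    have "(\<Sum>i<k. p i) \<le> C" for k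
    proof -
      have "(\<Sum>i<k. p i) \<le> (free_mode K tau (\<lambda>_. 0) b (k + tau))\<^sup>2 + (\<Sum>i<k. p i)" by simp
      also have "\<dots> \<le> E (\<lambda>_. 0) k"
        unfolding E_def p_def
        by (rule member_le_sum[OF b, where f = "\<lambda>b. (free_mode K tau (\<lambda>_. 0) b (k + tau))\<^sup>2
      + (\<Sum>i<k. (impulse (m b) tau (i + tau))\<^sup>2)"]) (auto intro!: add_nonneg_nonneg sum_nonneg B)
      also have "\<dots> \<le> C" using C[of k] by simp
      finally show ?thesis .
    qed
    then have "summable p"
      by (intro summableI_nonneg_bounded) (auto simp: p_def)
    then have "(\<lambda>n. sqrt (p n)) \<longlonglongrightarrow> sqrt 0"
      by (intro tendsto_real_sqrt summable_LIMSEQ_zero)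
    then have "(\<lambda>n. impulse (m b) tau (n + tau)) \<longlonglongrightarrow> 0"
      by (simp add: p_def tendsto_rabs_zero_iff)
    then have "impulse (m b) tau \<longlonglongrightarrow> 0"
      by (rule LIMSEQ_offset[of "impulse (m b) tau" tau])
    then show "m b \<in> {0<..<gain_bound tau}"
      using gain_range_if_impulse_tendsto_0[OF assms(2)] by simp
  next
    \<comment> \<open>Conversely, in each mode the free response dies out and the noise energy
      converges, so the finite sum over \<open>B\<close> converges for any history.\<close>
    fix h :: "int \<Rightarrow> real^'n"
    assume range: "\<forall>b\<in>B. m b \<in> {0<..<gain_bound tau}"
    have "convergent (\<lambda>k. (free_mode K tau h b (k + tau))\<^sup>2
      + (\<Sum>i<k. (impulse (m b) tau (i + tau))\<^sup>2))" if b: "b \<in> B" for b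
    proof -
      have sum: "summable (\<lambda>n. \<bar>impulse (m b) tau n\<bar>)"
        using range b by (intro summable_impulse_if_gain_range) auto
      then have "impulse (m b) tau \<longlonglongrightarrow> 0"
        using summable_LIMSEQ_zero tendsto_rabs_zero_iff by blast
      with free[OF b] have "free_mode K tau h b \<longlonglongrightarrow> 0"
        by (rule recurrence_tendsto_0)
      then have "(\<lambda>k. free_mode K tau h b (k + tau)) \<longlonglongrightarrow> 0"
        by (rule LIMSEQ_ignore_initial_segment)
      then have "convergent (\<lambda>k. (free_mode K tau h b (k + tau))\<^sup>2)"
        by (intro convergentI[OF tendsto_power])
      moreover have "summable (\<lambda>n. (impulse (m b) tau (n + tau))\<^sup>2)"
        using summable_square_if_abs_summable[OF sum]
        by (rule summable_ignore_initial_segment)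
      ultimately show ?thesis
        by (intro convergent_add) (simp_all add: summable_iff_convergent)
    qed
    then show "convergent (E h)"
      unfolding E_def by (intro convergent_sum)
  qed
  \<comment> \<open>The condition on \<open>B\<close> passes to the eigenvalue list because both
    range over the same set of values.\<close>
  moreover have "(\<forall>b\<in>B. m b \<in> {0<..<gain_bound tau})
      \<longleftrightarrow> (\<forall>x \<in> lam ` {2..CARD('n)}. x \<in> {0<..<gain_bound tau})"
    unfolding lam_B m_def by blast
  ultimately show ?thesis by simp
qed

end
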